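(* $R_1^{\Delta}(4,5)=8$, and up to isomorphism the unique extremal graph is the cycle $C_7$. That is, every triangle-free graph on $8$ vertices contains a $1$-dense set of $4$ vertices or a $1$-sparse set of $5$ vertices, and $C_7$ is, up to isomorphism, the only triangle-free graph on $7$ vertices containing neither.
   Context: All graphs are finite and simple. For an integer $k\ge0$, a set $S$ of vertices of a graph $G$ is $k$-sparse if the induced subgraph $G[S]$ has maximum degree at most $k$, and $k$-dense if every vertex of $S$ is non-adjacent to at most $k$ other vertices of $S$. $R_k^{\Delta}(i,j)$ denotes the least $n$ such that every triangle-free graph on $n$ vertices contains a $k$-dense set of $i$ vertices or a $k$-sparse set of $j$ vertices. An extremal graph for $R_k^{\Delta}(i,j)$ is a triangle-free graph on $R_k^{\Delta}(i,j)-1$ vertices containing neither a $k$-dense set of $i$ vertices nor a $k$-sparse set of $j$ vertices. *)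

theory Defs
  imports "Graph_Theory.Pair_Digraph" "Graph_Theory.Digraph_Isomorphism"
begin

text \<open>
  A finite simple graph is a \<open>pair_graph\<close>: a finite, loop-free and symmetric relation
  \<open>parcs G\<close> on \<open>pverts G\<close>, each edge \<open>uv\<close> being represented by the two arcs \<open>(u, v)\<close> and
  \<open>(v, u)\<close>.  The degree of a vertex is therefore its out-degree.
\<close>

definition triangle_free :: "'a pair_pre_digraph \<Rightarrow> bool" where
  "triangle_free G \<longleftrightarrow>
     \<not> (\<exists>u v w. (u, v) \<in> parcs G \<and> (v, w) \<in> parcs G \<and> (w, u) \<in> parcs G)"

definition sparse_set :: "nat \<Rightarrow> 'a pair_pre_digraph \<Rightarrow> 'a set \<Rightarrow> bool" where
  "sparse_set k G S \<longleftrightarrow>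
     S \<subseteq> pverts G \<and> (\<forall>v\<in>S. out_degree (with_proj G \<restriction> S) v \<le> k)"

definition dense_set :: "nat \<Rightarrow> 'a pair_pre_digraph \<Rightarrow> 'a set \<Rightarrow> bool" where
  "dense_set k G S \<longleftrightarrow>
     S \<subseteq> pverts G \<and> (\<forall>v\<in>S. card {u \<in> S. u \<noteq> v \<and> (v, u) \<notin> parcs G} \<le> k)"

definition has_dense_or_sparse :: "nat \<Rightarrow> nat \<Rightarrow> nat \<Rightarrow> 'a pair_pre_digraph \<Rightarrow> bool" where
  "has_dense_or_sparse k i j G \<longleftrightarrow>
     (\<exists>S. dense_set k G S \<and> card S = i) \<or> (\<exists>S. sparse_set k G S \<and> card S = j)"

text \<open>
  The vertices are taken from \<open>nat\<close>; this loses nothing, since every finite graph is isomorphic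
  to one whose vertices are natural numbers.
\<close>

definition R_triangle :: "nat \<Rightarrow> nat \<Rightarrow> nat \<Rightarrow> nat" where
  "R_triangle k i j =
     (LEAST n. \<forall>G :: nat pair_pre_digraph.
        pair_graph G \<and> triangle_free G \<and> card (pverts G) = n \<longrightarrow> has_dense_or_sparse k i j G)"

definition extremal :: "nat \<Rightarrow> nat \<Rightarrow> nat \<Rightarrow> 'a pair_pre_digraph \<Rightarrow> bool" where
  "extremal k i j G \<longleftrightarrow>
     pair_graph G \<and> triangle_free G \<and> card (pverts G) = R_triangle k i j - 1 \<and>
     \<not> has_dense_or_sparse k i j G"

text \<open>The cycle \<open>C\<^sub>n\<close>, meaningful for \<open>n \<ge> 3\<close>.\<close>

definition cycle_graph :: "nat \<Rightarrow> nat pair_pre_digraph" where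
  "cycle_graph n =
     \<lparr> pverts = {..<n},
       parcs = {(u, v). u < n \<and> v < n \<and> (v = (u + 1) mod n \<or> u = (v + 1) mod n)} \<rparr>"

text \<open>
  For graphs given by pairs, an isomorphism in the sense of \<open>digraph_iso\<close> acts on arcs by
  \<open>(u, v) \<mapsto> (f u, f v)\<close> where \<open>f\<close> is its action on the vertices.
\<close>

definition graph_iso :: "'a pair_pre_digraph \<Rightarrow> 'b pair_pre_digraph \<Rightarrow> bool" where
  "graph_iso G H \<longleftrightarrow> digraph_iso (with_proj G) (with_proj H)"

end

theory Submission
  imports Defs
begin

text \<open>
  In a triangle-free graph the 1-dense 4-sets are exactly the 4-cycles, so the question is about
  graphs of girth at least 5.  There, on at least 7 vertices without a 1-sparse 5-set, every
  degree is at most 2: the neighbours of a vertex of degree at least 4, with another vertex added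
  if necessary, contain a 1-sparse 5-set; around a vertex of degree 3 any two non-adjacent
  vertices outside its closed neighbourhood must share a neighbour inside its neighbourhood, which
  for three such vertices forces a vertex of degree 4 or a 4-cycle.  On 7 vertices a vertex of
  degree at most 1 also yields a 1-sparse 5-set, so the graph is 2-regular of girth at least 5,
  hence \<open>C\<^sub>7\<close>.  On 8 vertices every vertex-deleted subgraph would be 2-regular while the whole
  graph has maximum degree 2, which is impossible.
\<close>

section \<open>1-sparse sets in small graphs of girth at least 5\<close>

lemma card_less_2_cases:
  assumes "finite S" "card S < 2"
  obtains "S = {}" | p where "S = {p}"
  using assms by (cases "card S = 0") (auto simp: less_2_cases_iff card_1_singleton_iff)

text \<open>Adjacency lives on the whole type and vertex sets are passed as arguments, so deleting
  vertices only means shrinking a set. The condition \<open>no_C4\<close> concerns closed walks of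
  length 4, which may also be degenerate, hence its disjunction.\<close>

locale girth_ge_5 =
  fixes adj :: "'a \<Rightarrow> 'a \<Rightarrow> bool"
  assumes sym: "adj u v \<Longrightarrow> adj v u"
    and irrefl: "\<not> adj u u"
    and no_C3: "adj a b \<Longrightarrow> adj b c \<Longrightarrow> \<not> adj c a"
    and no_C4: "adj a b \<Longrightarrow> adj b c \<Longrightarrow> adj c d \<Longrightarrow> adj d a \<Longrightarrow> a = c \<or> b = d"
begin

definition nbrs :: "'a set \<Rightarrow> 'a \<Rightarrow> 'a set" where
  "nbrs A v = {w \<in> A. adj v w}"

text \<open>Degree at most 1 is phrased as uniqueness of the neighbour, which keeps cardinalities
  out of the arguments.\<close>

definition sparse1 :: "'a set \<Rightarrow> bool" where
  "sparse1 S \<longleftrightarrow> (\<forall>v\<in>S. \<forall>a\<in>S. \<forall>b\<in>S. adj v a \<longrightarrow> adj v b \<longrightarrow> a = b)"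

definition has_sparse :: "'a set \<Rightarrow> nat \<Rightarrow> bool" where
  "has_sparse A j \<longleftrightarrow> (\<exists>S\<subseteq>A. card S = j \<and> sparse1 S)"

lemma adj_commute: "adj u v \<longleftrightarrow> adj v u"
  using sym by blast

lemma card_nbrs_mono: "finite B \<Longrightarrow> A \<subseteq> B \<Longrightarrow> card (nbrs A v) \<le> card (nbrs B v)"
  by (rule card_mono) (auto simp: nbrs_def)

lemma sparse1_Un:
  assumes "sparse1 S" "sparse1 T" "\<And>s t. s \<in> S \<Longrightarrow> t \<in> T \<Longrightarrow> \<not> adj s t"
  shows "sparse1 (S \<union> T)"
  unfolding sparse1_def
proof (intro ballI impI)
  fix v a b
  assume v: "v \<in> S \<union> T" "a \<in> S \<union> T" "b \<in> S \<union> T" "adj v a" "adj v b"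
  have no_edge: "\<not> adj t s" if "s \<in> S" "t \<in> T" for s t
    using assms(3) that sym by blast
  from v(1) show "a = b"
  proof
    assume "v \<in> S"
    then have "a \<in> S" "b \<in> S"
      using v assms(3) by blast+
    with \<open>v \<in> S\<close> v(4,5) assms(1) show ?thesis
      unfolding sparse1_def by blast
  next
    assume "v \<in> T"
    then have "a \<in> T" "b \<in> T"
      using v no_edge by blast+
    with \<open>v \<in> T\<close> v(4,5) assms(2) show ?thesis
      unfolding sparse1_def by blast
  qed
qed

lemma sparse1_subset: "sparse1 S \<Longrightarrow> T \<subseteq> S \<Longrightarrow> sparse1 T"
  unfolding sparse1_def by blast

lemma sparse1_pair: "sparse1 {a, b}"
  using irrefl by (auto simp: sparse1_def)

lemma has_sparseI:
  assumes "finite S" "S \<subseteq> A" "sparse1 S" "j \<le> card S"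
  shows "has_sparse A j"
proof -
  obtain T where "T \<subseteq> S" "card T = j"
    using assms(4) by (rule obtain_subset_with_card_n)
  then show ?thesis
    using assms(2,3) sparse1_subset unfolding has_sparse_def by blast
qed

lemma has_sparse_mono: "has_sparse A j \<Longrightarrow> A \<subseteq> B \<Longrightarrow> has_sparse B j"
  unfolding has_sparse_def by blast

text \<open>A triple that is not 1-sparse is a path with centre \<open>z\<close> and ends
  \<open>a\<close>, \<open>b\<close>. If exchanging \<open>z\<close> for the fourth vertex
  \<open>w\<close> fails as well, then \<open>w\<close> is also adjacent to both ends, and
  \<open>z a w b\<close> is a 4-cycle.\<close>

lemma has_sparse_4_3:
  assumes "card A = 4"
  shows "has_sparse A 3"
proof (rule ccontr)
  assume neg: "\<not> has_sparse A 3"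
  have fin: "finite A"
    using assms by (simp add: card_ge_0_finite)
  have "3 \<le> card A"
    using assms by simp
  then obtain B where "B \<subseteq> A" "card B = 3"
    by (rule obtain_subset_with_card_n)
  with neg have "\<not> sparse1 B"
    by (auto simp: has_sparse_def)
  then obtain z a b where zab: "z \<in> A" "a \<in> A" "b \<in> A" "adj z a" "adj z b" "a \<noteq> b"
    using \<open>B \<subseteq> A\<close> unfolding sparse1_def by blast
  have "z \<noteq> a" "z \<noteq> b"
    using zab irrefl by auto
  have "card (A - {z, a, b}) = 1"
    using assms zab \<open>z \<noteq> a\<close> \<open>z \<noteq> b\<close> fin by (simp add: card_Diff_subset)
  then obtain w where w: "A - {z, a, b} = {w}"
    by (auto simp: card_1_singleton_iff)
  then have "w \<in> A" "w \<notin> {z, a, b}"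
    by blast+
  have "\<not> sparse1 {a, b, w}"
    using neg zab w \<open>w \<in> A\<close> \<open>w \<notin> {z, a, b}\<close> by (auto simp: has_sparse_def)
  moreover have "\<not> adj a b"
    using no_C3 zab sym by blast
  ultimately have "adj w a" "adj w b"
    using sym irrefl unfolding sparse1_def by blast+
  then show False
    using no_C4[of z a w b] zab sym \<open>w \<notin> {z, a, b}\<close> by blast
qed

text \<open>
  An end \<open>u\<close> of a path can be kept together with its neighbour \<open>p\<close> at the price of deleting only
  the next vertex \<open>x\<close> of the path.
\<close>

lemma peel_path_end:
  assumes A: "finite A" "3 \<le> card A" "\<And>v. v \<in> A \<Longrightarrow> card (nbrs A v) \<le> 2"
    and u: "u \<in> A" "nbrs A u = {p}"
  obtains x where "x \<in> A" "x \<noteq> u" "x \<noteq> p" "p \<in> A" "p \<noteq> u"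
    "\<And>T. T \<subseteq> A - {u, p, x} \<Longrightarrow> sparse1 T \<Longrightarrow> sparse1 ({u, p} \<union> T)"
proof -
  have p: "p \<in> A" "adj u p" "p \<noteq> u"
    using u(2) irrefl by (auto simp: nbrs_def)
  \<comment> \<open>If \<open>p\<close> has a second neighbour, that is \<open>x\<close>; otherwise
    any third vertex serves, and one exists because \<open>A\<close> has at least 3
    elements.\<close>
  have "\<exists>x\<in>A. x \<noteq> u \<and> x \<noteq> p \<and> nbrs A p \<subseteq> {u, x}"
  proof (cases "nbrs A p = {u}")
    case True
    have "A - {u, p} \<noteq> {}"
      using A(2) card_mono[of "{u, p}" A] p(3) by force
    then show ?thesis
      using True by blast
  next
    case False
    have "u \<in> nbrs A p"
      using u sym[OF p(2)] by (auto simp: nbrs_def)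
    with False obtain x where x: "x \<in> nbrs A p" "x \<noteq> u"
      by blast
    have "finite (nbrs A p)"
      using A(1) by (simp add: nbrs_def)
    then have "nbrs A p = {u, x}"
      using A(3)[OF p(1)] x \<open>u \<in> nbrs A p\<close> card_seteq[of "nbrs A p" "{u, x}"] by auto
    then show ?thesis
      using x irrefl by (auto simp: nbrs_def)
  qed
  then obtain x where x: "x \<in> A" "x \<noteq> u" "x \<noteq> p" "nbrs A p \<subseteq> {u, x}"
    by blast
  have "sparse1 ({u, p} \<union> T)" if "T \<subseteq> A - {u, p, x}" "sparse1 T" for T
  proof (rule sparse1_Un[OF sparse1_pair that(2)])
    fix s t assume "s \<in> {u, p}" "t \<in> T"
    then show "\<not> adj s t"
      using that(1) u(2) x(4) unfolding nbrs_def by blast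
  qed
  with x p that show thesis
    by blast
qed

text \<open>Deleting one end \<open>t\<close> of an edge leaves five vertices among which the other
  end \<open>a\<close> has degree at most 1. If \<open>a\<close> is isolated there, it extends a
  1-sparse 3-set of the other four. If it has one neighbour \<open>p\<close>, peeling off
  \<open>a\<close>, \<open>p\<close> at the cost of \<open>x\<close> leaves two vertices, always a
  1-sparse pair.\<close>

lemma has_sparse_6_4:
  assumes A: "card A = 6" "\<And>v. v \<in> A \<Longrightarrow> card (nbrs A v) \<le> 2"
  shows "has_sparse A 4"
proof (cases "sparse1 A")
  case True
  then show ?thesis
    using A(1) by (intro has_sparseI[of A]) (auto simp: card_ge_0_finite)
next
  case False
  have fin: "finite A"
    using A(1) by (simp add: card_ge_0_finite)
  obtain t a where t: "t \<in> A" "a \<in> A" "adj t a"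
    using False unfolding sparse1_def by blast
  then have "a \<noteq> t"
    using irrefl by blast
  define B where "B = A - {t}"
  have B: "finite B" "card B = 5" "a \<in> B" "B \<subseteq> A"
    using fin A(1) t \<open>a \<noteq> t\<close> by (auto simp: B_def)
  have degB: "card (nbrs B v) \<le> 2" if "v \<in> B" for v
    using card_nbrs_mono[OF fin B(4)] A(2) that B(4) by (meson le_trans subsetD)
  have fin_nbrs: "finite (nbrs A a)"
    using fin by (simp add: nbrs_def)
  have "nbrs B a \<subset> nbrs A a"
    using t sym[OF t(3)] by (auto simp: nbrs_def B_def)
  from psubset_card_mono[OF fin_nbrs this] have "card (nbrs B a) < 2"
    using A(2)[OF t(2)] by linarith
  moreover have "finite (nbrs B a)"
    using B(1) by (simp add: nbrs_def)
  ultimately consider "nbrs B a = {}" | p where "nbrs B a = {p}"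
    using card_less_2_cases by blast
  then show ?thesis
  proof cases
    case 1
    have "card (B - {a}) = 4"
      using B by simp
    then obtain T where T: "T \<subseteq> B - {a}" "card T = 3" "sparse1 T"
      using has_sparse_4_3 unfolding has_sparse_def by blast
    \<comment> \<open>Writing the singleton as \<open>{a, a}\<close> lets
      \<open>sparse1_pair\<close> apply to it.\<close>
    have "sparse1 ({a, a} \<union> T)"
      using T 1 by (intro sparse1_Un sparse1_pair) (auto simp: nbrs_def)
    moreover have "finite T" "a \<notin> T"
      using T B finite_subset[of T B] by auto
    moreover from this have "card ({a, a} \<union> T) = 4"
      using T by simp
    ultimately show ?thesis
      using T B by (intro has_sparseI[of "{a, a} \<union> T"]) auto
  next
    case 2
    obtain x where x: "x \<in> B" "x \<noteq> a" "x \<noteq> p" "p \<in> B" "p \<noteq> a"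
      and T: "\<And>T. T \<subseteq> B - {a, p, x} \<Longrightarrow> sparse1 T \<Longrightarrow> sparse1 ({a, p} \<union> T)"
      using peel_path_end[of B a p] B degB 2 by auto
    have cd: "card (B - {a, p, x}) = 2"
      using B x by (simp add: card_Diff_subset)
    then obtain y z where "B - {a, p, x} = {y, z}"
      unfolding card_2_iff by blast
    then have "sparse1 (B - {a, p, x})"
      using sparse1_pair by simp
    then have "sparse1 ({a, p} \<union> (B - {a, p, x}))"
      using T by blast
    moreover have "card ({a, p} \<union> (B - {a, p, x})) = 4"
      using cd x B by (subst card_Un_disjoint) auto
    ultimately show ?thesis
      using B x by (intro has_sparseI[of "{a, p} \<union> (B - {a, p, x})"]) auto
  qed
qed

text \<open>An isolated \<open>u\<close> is added to a 1-sparse 4-set of the other six vertices. A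
  \<open>u\<close> with a single neighbour \<open>p\<close> is peeled off together with
  \<open>p\<close>, and the four vertices that remain contain a 1-sparse 3-set.\<close>

lemma has_sparse_7_5:
  assumes A: "card A = 7" "\<And>v. v \<in> A \<Longrightarrow> card (nbrs A v) \<le> 2"
    and u: "u \<in> A" "card (nbrs A u) < 2"
  shows "has_sparse A 5"
proof -
  have fin: "finite A"
    using A(1) by (simp add: card_ge_0_finite)
  then have "finite (nbrs A u)"
    by (simp add: nbrs_def)
  then consider "nbrs A u = {}" | p where "nbrs A u = {p}"
    using u(2) by (rule card_less_2_cases)
  then show ?thesis
  proof cases
    case 1
    have "card (nbrs (A - {u}) v) \<le> 2" if "v \<in> A - {u}" for v
      using card_nbrs_mono[OF fin, of "A - {u}" v] A(2)[of v] that by force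
    then obtain T where T: "T \<subseteq> A - {u}" "card T = 4" "sparse1 T"
      using has_sparse_6_4[of "A - {u}"] A(1) u(1) fin unfolding has_sparse_def by auto
    have "sparse1 ({u, u} \<union> T)"
      using T 1 by (intro sparse1_Un sparse1_pair) (auto simp: nbrs_def)
    moreover have "finite T" "u \<notin> T"
      using T fin finite_subset[of T A] by auto
    moreover from this have "card ({u, u} \<union> T) = 5"
      using T by simp
    ultimately show ?thesis
      using T u by (intro has_sparseI[of "{u, u} \<union> T"]) auto
  next
    case 2
    obtain x where x: "x \<in> A" "x \<noteq> u" "x \<noteq> p" "p \<in> A" "p \<noteq> u"
      and ext: "\<And>T. T \<subseteq> A - {u, p, x} \<Longrightarrow> sparse1 T \<Longrightarrow> sparse1 ({u, p} \<union> T)"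
      using peel_path_end[of A u p] fin A u 2 by auto
    have "card (A - {u, p, x}) = 4"
      using fin A u x by (simp add: card_Diff_subset)
    then obtain T where T: "T \<subseteq> A - {u, p, x}" "card T = 3" "sparse1 T"
      using has_sparse_4_3 unfolding has_sparse_def by blast
    have "finite T"
      using T fin finite_subset by blast
    have "card ({u, p} \<union> T) = 5"
      using T x \<open>finite T\<close> by (subst card_Un_disjoint) auto
    then show ?thesis
      using T x u ext[OF T(1,3)] \<open>finite T\<close> by (intro has_sparseI[of "{u, p} \<union> T"]) auto
  qed
qed

section \<open>Degree bounds from neighbourhoods\<close>

lemma nbrs_indep: "a \<in> nbrs A v \<Longrightarrow> b \<in> nbrs A v \<Longrightarrow> \<not> adj a b"
  using no_C3[of v a b] sym[of v b] by (auto simp: nbrs_def)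

lemma common_nbr_unique:
  assumes "a \<in> nbrs A v" "b \<in> nbrs A v" "adj w a" "adj w b" "w \<noteq> v"
  shows "a = b"
  using no_C4[of v a w b] assms sym[of w a] sym[of v b] by (simp add: nbrs_def)

text \<open>The neighbourhood is independent by triangle-freeness, and two neighbours of
  \<open>w\<close> in it would close a 4-cycle through \<open>v\<close>. So the set spans at most
  one edge.\<close>

lemma sparse1_insert_nbrs:
  assumes "w \<noteq> v"
  shows "sparse1 (insert w (nbrs A v))"
  unfolding sparse1_def
proof (intro ballI impI)
  fix x a b
  assume x: "x \<in> insert w (nbrs A v)" "a \<in> insert w (nbrs A v)" "b \<in> insert w (nbrs A v)"
    "adj x a" "adj x b"
  show "a = b"
  proof (cases "x \<in> nbrs A v")
    case True
    then show ?thesis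
      using x nbrs_indep by blast
  next
    case False
    then have "x = w"
      using x by blast
    then have "a \<in> nbrs A v" "b \<in> nbrs A v"
      using x irrefl by blast+
    then show ?thesis
      using common_nbr_unique x assms \<open>x = w\<close> by blast
  qed
qed

lemma degree_le_3:
  assumes A: "6 \<le> card A" and "\<not> has_sparse A 5" "v \<in> A"
  shows "card (nbrs A v) \<le> 3"
proof (rule ccontr)
  assume deg: "\<not> ?thesis"
  have fin: "finite A"
    using A by (metis card.infinite not_numeral_le_zero)
  then have fin_nbrs: "finite (nbrs A v)"
    by (simp add: nbrs_def)
  \<comment> \<open>For degree exactly 4 the closed neighbourhood has only five vertices, so a sixth
    vertex lies outside it. For larger degree any neighbour will do, since inserting it changes
    nothing.\<close>
  have "\<exists>w. w \<noteq> v \<and> w \<in> A \<and> (card (nbrs A v) = 4 \<longrightarrow> w \<notin> nbrs A v)"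
  proof (cases "card (nbrs A v) = 4")
    case True
    have "card (insert v (nbrs A v)) \<le> 5"
      using True fin_nbrs by (simp add: card_insert_if)
    then have "\<not> A \<subseteq> insert v (nbrs A v)"
      using A fin_nbrs card_mono[of "insert v (nbrs A v)" A] by auto
    then show ?thesis
      by blast
  next
    case False
    obtain w where "w \<in> nbrs A v"
      using deg by fastforce
    then have "w \<noteq> v" "w \<in> A"
      using irrefl by (auto simp: nbrs_def)
    with False show ?thesis
      by blast
  qed
  then obtain w where w: "w \<noteq> v" "w \<in> A" "card (nbrs A v) = 4 \<longrightarrow> w \<notin> nbrs A v"
    by blast
  have "5 \<le> card (insert w (nbrs A v))"
    using deg w fin_nbrs by (auto simp: card_insert_if)
  then have "has_sparse A 5"
    using sparse1_insert_nbrs[OF w(1)] w(2) fin_nbrs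
    by (intro has_sparseI[of "insert w (nbrs A v)"]) (auto simp: nbrs_def)
  then show False
    using assms(2) by blast
qed

text \<open>The two vertices and the three neighbours of \<open>v\<close> form a 5-set in which
  \<open>w\<close> and \<open>w'\<close> each see at most one neighbour of \<open>v\<close>. Only a
  neighbour of \<open>v\<close> adjacent to both can keep it from being 1-sparse.\<close>

lemma common_nbr_if_degree_3:
  assumes A: "\<not> has_sparse A 5" "finite A" "card (nbrs A v) = 3"
    and w: "w \<in> A - insert v (nbrs A v)" "w' \<in> A - insert v (nbrs A v)" "w \<noteq> w'" "\<not> adj w w'"
  shows "\<exists>s\<in>nbrs A v. adj w s \<and> adj w' s"
proof (rule ccontr)
  assume neg: "\<not> ?thesis"
  let ?S = "insert w (insert w' (nbrs A v))"
  have fin_nbrs: "finite (nbrs A v)"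
    using A(2) by (simp add: nbrs_def)
  have "a = b" if "x \<in> ?S" "a \<in> ?S" "b \<in> ?S" "adj x a" "adj x b" for x a b
  proof (cases "x \<in> nbrs A v")
    case True
    then show ?thesis
      using that neg nbrs_indep[of x A v] sym by blast
  next
    case False
    then have "x \<noteq> v" "a \<in> nbrs A v" "b \<in> nbrs A v"
      using that w irrefl sym by blast+
    then show ?thesis
      using that common_nbr_unique by blast
  qed
  then have "sparse1 ?S"
    unfolding sparse1_def by blast
  moreover have "card ?S = 5"
    using A(3) w fin_nbrs by simp
  ultimately have "has_sparse A 5"
    using w fin_nbrs by (intro has_sparseI[of ?S]) (auto simp: nbrs_def)
  then show False
    using A(1) by blast
qed

lemma degree_le_2:
  assumes A: "7 \<le> card A" "\<not> has_sparse A 5" and v: "v \<in> A"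
  shows "card (nbrs A v) \<le> 2"
proof (rule ccontr)
  assume "\<not> ?thesis"
  moreover have deg3: "card (nbrs A u) \<le> 3" if "u \<in> A" for u
    using degree_le_3 A that by simp
  ultimately have deg: "card (nbrs A v) = 3"
    using v by force
  have fin: "finite A"
    using A(1) by (metis card.infinite not_numeral_le_zero)
  then have fin_nbrs: "finite (nbrs A u)" for u
    by (simp add: nbrs_def)
  define W where "W = A - insert v (nbrs A v)"
  have "v \<notin> nbrs A v"
    using irrefl by (simp add: nbrs_def)
  then have "card (insert v (nbrs A v)) = 4"
    using deg fin_nbrs by simp
  then have "3 \<le> card W"
    using A(1) fin_nbrs diff_card_le_card_Diff[of "insert v (nbrs A v)" A] by (simp add: W_def)
  then obtain X where "X \<subseteq> W" "card X = 3"
    by (rule obtain_subset_with_card_n)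
  then obtain x y z where xyz: "x \<in> W" "y \<in> W" "z \<in> W" "x \<noteq> y" "x \<noteq> z" "y \<noteq> z"
    unfolding card_3_iff by blast
  have common: "\<exists>s\<in>nbrs A v. adj w s \<and> adj w' s"
    if "w \<in> W" "w' \<in> W" "w \<noteq> w'" "\<not> adj w w'" for w w'
    using common_nbr_if_degree_3[OF A(2) fin deg] that unfolding W_def by blast
  \<comment> \<open>Three vertices outside the closed neighbourhood are not a triangle; call a
    non-adjacent pair \<open>a\<close>, \<open>b\<close> and the third vertex
    \<open>c\<close>.\<close>
  have "\<not> adj x y \<or> \<not> adj x z \<or> \<not> adj y z"
    using no_C3 sym by blast
  then obtain a b c where abc: "a \<in> W" "b \<in> W" "c \<in> W" "a \<noteq> b" "a \<noteq> c" "b \<noteq> c" "\<not> adj a b"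
    using xyz by metis
  obtain s where s: "s \<in> nbrs A v" "adj a s" "adj b s"
    using common abc by blast
  \<comment> \<open>Otherwise \<open>s\<close> would have the four neighbours \<open>v\<close>,
    \<open>a\<close>, \<open>b\<close>, \<open>c\<close>.\<close>
  have "\<not> adj s c"
  proof
    assume "adj s c"
    then have "{v, a, b, c} \<subseteq> nbrs A s"
      using abc s v sym unfolding nbrs_def W_def by blast
    moreover have "card {v, a, b, c} = 4"
      using abc by (auto simp: W_def)
    ultimately show False
      using card_mono[OF fin_nbrs, of "{v, a, b, c}" s] deg3[of s] s(1) by (auto simp: nbrs_def)
  qed
  \<comment> \<open>If \<open>a\<close> and \<open>c\<close> were not adjacent, they would share a
    neighbour adjacent to \<open>v\<close>; the only such neighbour of \<open>a\<close> is
    \<open>s\<close>, which is not adjacent to \<open>c\<close>. The same holds for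
    \<open>b\<close>.\<close>
  then have "adj a c" "adj b c"
    using common[of a c] common[of b c] common_nbr_unique[OF s(1)] s abc sym
    unfolding W_def by blast+
  then show False
    using no_C4[of a c b s] s abc sym unfolding W_def by blast
qed

lemma degree_eq_2:
  assumes "card A = 7" "\<not> has_sparse A 5" "v \<in> A"
  shows "card (nbrs A v) = 2"
proof -
  have deg: "card (nbrs A u) \<le> 2" if "u \<in> A" for u
    using degree_le_2 that assms by simp
  have "\<not> card (nbrs A v) < 2"
    using has_sparse_7_5[OF assms(1) deg assms(3)] assms(2) by blast
  with deg[OF assms(3)] show ?thesis
    by linarith
qed

text \<open>Otherwise every vertex-deleted subgraph is 2-regular. A vertex \<open>u\<close> keeps
  degree 2 after its neighbour \<open>w\<close> is deleted, so it has degree at least 3 in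
  \<open>A\<close>, against \<open>degree_le_2\<close>.\<close>

lemma has_sparse_8_5:
  assumes A: "card A = 8"
  shows "has_sparse A 5"
proof (rule ccontr)
  assume neg: "\<not> has_sparse A 5"
  have fin: "finite A"
    using A by (simp add: card_ge_0_finite)
  have deg: "card (nbrs (A - {v}) u) = 2" if "u \<in> A" "v \<in> A" "u \<noteq> v" for u v
  proof (rule degree_eq_2)
    show "card (A - {v}) = 7"
      using A that(2) by simp
    show "\<not> has_sparse (A - {v}) 5"
      using neg has_sparse_mono by blast
    show "u \<in> A - {v}"
      using that by blast
  qed
  obtain u v where uv: "u \<in> A" "v \<in> A" "u \<noteq> v"
    using A card_le_Suc0_iff_eq[OF fin] by force
  obtain w where w: "w \<in> nbrs (A - {v}) u"
    using deg[OF uv] by fastforce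
  then have "w \<in> A" "w \<noteq> u"
    using irrefl by (auto simp: nbrs_def)
  have "finite (nbrs A u)"
    using fin by (simp add: nbrs_def)
  moreover have "nbrs (A - {w}) u \<subset> nbrs A u"
    using w by (auto simp: nbrs_def)
  ultimately have "card (nbrs (A - {w}) u) < card (nbrs A u)"
    by (rule psubset_card_mono)
  moreover have "card (nbrs A u) \<le> 2"
    using degree_le_2 A neg uv by simp
  moreover have "card (nbrs (A - {w}) u) = 2"
    using deg[OF uv(1) \<open>w \<in> A\<close>] \<open>w \<noteq> u\<close> by blast
  ultimately show False
    by linarith
qed

section \<open>2-regular graphs of girth at least 5 on 7 vertices\<close>

lemma second_nbr:
  assumes "card (nbrs A u) = 2" "adj u w" "w \<in> A"
  obtains x where "x \<noteq> w" "nbrs A u = {w, x}"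
proof -
  have "w \<in> nbrs A u"
    using assms by (simp add: nbrs_def)
  then have "card (nbrs A u - {w}) = 1"
    using assms(1) by simp
  then obtain x where "nbrs A u - {w} = {x}"
    by (rule card_1_singletonE)
  with \<open>w \<in> nbrs A u\<close> show thesis
    using that[of x] by blast
qed

text \<open>Walking two steps both ways from \<open>t\<close> gives a path \<open>c a t b d\<close>
  on five distinct vertices. The degrees of \<open>t\<close>, \<open>a\<close>, \<open>b\<close> are
  then used up, so the remaining two vertices must continue the path at \<open>c\<close> and
  \<open>d\<close> and be joined to each other.\<close>

lemma two_regular_7:
  assumes A: "card A = 7" and reg: "\<And>v. v \<in> A \<Longrightarrow> card (nbrs A v) = 2"
  obtains g where "bij_betw g {..<7::nat} A"
    "\<And>i j. i < 7 \<Longrightarrow> j < 7 \<Longrightarrow> adj (g i) (g j) \<longleftrightarrow> j = (i + 1) mod 7 \<or> i = (j + 1) mod 7"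
proof -
  have fin: "finite A"
    using A by (simp add: card_ge_0_finite)
  have nbrsD: "adj u v \<longleftrightarrow> v \<in> N" if "nbrs A u = N" "v \<in> A" for u v N
    using that by (auto simp: nbrs_def)
  obtain t where t: "t \<in> A"
    using A by fastforce
  obtain a b where Nt: "nbrs A t = {a, b}" "a \<noteq> b"
    using reg[OF t] by (auto simp: card_2_iff)
  then have ab: "a \<in> A" "b \<in> A" "adj t a" "adj t b"
    by (auto simp: nbrs_def)
  obtain c where Na: "nbrs A a = {t, c}" "c \<noteq> t"
    using second_nbr[OF reg[OF ab(1)] sym[OF ab(3)] t] by auto
  obtain d where Nb: "nbrs A b = {t, d}" "d \<noteq> t"
    using second_nbr[OF reg[OF ab(2)] sym[OF ab(4)] t] by auto
  have cd: "c \<in> A" "d \<in> A" "adj a c" "adj b d"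
    using Na Nb by (auto simp: nbrs_def)
  have "c \<noteq> a" "d \<noteq> b" "a \<noteq> t" "b \<noteq> t"
    using cd ab irrefl by auto
  moreover have "c \<noteq> b" "d \<noteq> a"
    using no_C3 ab cd sym by blast+
  \<comment> \<open>If \<open>c\<close> and \<open>d\<close> coincided, \<open>t a c b\<close> would
    be a 4-cycle.\<close>
  moreover have "c \<noteq> d"
    using no_C4[of t a c b] ab cd Na Nt(2) sym by blast
  ultimately have dist5: "distinct [t, a, b, c, d]"
    using Na Nb Nt by auto
  have "card (A - {t, a, b, c, d}) = 2"
    using A t ab cd dist5 by (subst card_Diff_subset) auto
  then obtain x y where xy: "A - {t, a, b, c, d} = {x, y}" "x \<noteq> y"
    by (auto simp: card_2_iff)
  obtain e where Nc: "nbrs A c = {a, e}" "e \<noteq> a"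
    using second_nbr[OF reg[OF cd(1)] sym[OF cd(3)] ab(1)] by auto
  obtain f where Nd: "nbrs A d = {b, f}" "f \<noteq> b"
    using second_nbr[OF reg[OF cd(2)] sym[OF cd(4)] ab(2)] by auto
  have ef: "e \<in> A" "f \<in> A" "adj c e" "adj d f"
    using Nc Nd by (auto simp: nbrs_def)
  have isolated: "\<not> adj v w" if "v \<in> {x, y}" "w \<in> {t, a, b}" for v w
  proof -
    have "v \<in> A" "v \<notin> {t, a, b, c, d}"
      using that(1) xy by blast+
    then show ?thesis
      using that(2) nbrsD[OF Nt(1)] nbrsD[OF Na(1)] nbrsD[OF Nb(1)] sym by blast
  qed
  have two: "\<exists>p q. p \<noteq> q \<and> p \<in> A \<and> q \<in> A \<and> adj v p \<and> adj v q" if "v \<in> A" for v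
    using reg[OF that] by (auto simp: card_2_iff nbrs_def)
  have xyA: "A = {t, a, b, c, d, x, y}"
    using xy t ab cd by auto
  \<comment> \<open>Each of \<open>x\<close>, \<open>y\<close> has two neighbours among
    \<open>c\<close>, \<open>d\<close> and the other one, hence is adjacent to \<open>c\<close> or
    \<open>d\<close>; the only free places there are \<open>e\<close> and \<open>f\<close>.\<close>
  have "v = e \<or> v = f" if v: "v \<in> {x, y}" for v
  proof -
    have "v \<in> A" "v \<noteq> a" "v \<noteq> b"
      using v xy by blast+
    obtain p q where pq: "p \<noteq> q" "p \<in> A" "q \<in> A" "adj v p" "adj v q"
      using two[OF \<open>v \<in> A\<close>] by blast
    then have "p \<in> {c, d, x, y}" "q \<in> {c, d, x, y}"
      using isolated[OF v] xyA by auto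
    moreover have "p \<noteq> v" "q \<noteq> v"
      using pq irrefl by auto
    ultimately have "adj v c \<or> adj v d"
      using pq v by auto
    then have "adj c v \<or> adj d v"
      using sym by blast
    then show ?thesis
      using nbrsD[OF Nc(1) \<open>v \<in> A\<close>] nbrsD[OF Nd(1) \<open>v \<in> A\<close>] \<open>v \<noteq> a\<close> \<open>v \<noteq> b\<close> by auto
  qed
  then have "e = x \<and> f = y \<or> e = y \<and> f = x"
    using xy(2) by blast
  then have dist: "distinct [t, a, c, e, f, d, b]" and set: "A = set [t, a, c, e, f, d, b]"
    and ef_xy: "e \<in> {x, y}"
    using dist5 xy xyA by auto
  have "adj e f"
  proof -
    have "\<not> adj e d"
      using nbrsD[OF Nd(1) ef(1)] dist by (auto simp: adj_commute)
    then show ?thesis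
      using two[OF ef(1)] isolated[OF ef_xy] irrefl set by force
  qed
  \<comment> \<open>The list runs once around the cycle, its last entry \<open>b\<close> being
    adjacent to its first entry \<open>t\<close>.\<close>
  define g where "g i = [t, a, c, e, f, d, b] ! i" for i
  have bij: "bij_betw g {..<7} A"
    using bij_betw_nth[OF dist, of "{..<7}" A] set by (simp add: g_def [abs_def])
  have succ: "adj (g i) (g ((i + 1) mod 7))" if "i < 7" for i
  proof -
    have "i = 0 \<or> i = 1 \<or> i = 2 \<or> i = 3 \<or> i = 4 \<or> i = 5 \<or> i = 6"
      using that by linarith
    then show ?thesis
      using ab cd ef \<open>adj e f\<close> by (auto simp: g_def adj_commute)
  qed
  have "j = (i + 1) mod 7 \<or> i = (j + 1) mod 7" if ij: "i < 7" "j < 7" "adj (g i) (g j)" for i j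
  proof -
    have gA: "g k \<in> A" if "k < 7" for k
      using bij that by (auto simp: bij_betw_def)
    have g_eq: "k = l" if "g k = g l" "k < 7" "l < 7" for k l
      using bij that by (auto simp: bij_betw_def inj_on_def)
    \<comment> \<open>The predecessor of \<open>i\<close> modulo 7, written without subtraction on
      \<open>nat\<close>.\<close>
    define p where "p = (i + 6) mod 7"
    define q where "q = (i + 1) mod 7"
    have pq: "p < 7" "q < 7"
      by (simp_all add: p_def q_def)
    have "i = 0 \<or> i = 1 \<or> i = 2 \<or> i = 3 \<or> i = 4 \<or> i = 5 \<or> i = 6"
      using ij(1) by linarith
    then have pq': "(p + 1) mod 7 = i" "p \<noteq> q"
      by (auto simp: p_def q_def)
    \<comment> \<open>The two cycle neighbours already exhaust the degree 2, so there are no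
      chords.\<close>
    have "{g p, g q} \<subseteq> nbrs A (g i)"
      using sym[OF succ[of p]] succ[of i] pq pq' ij gA by (auto simp: nbrs_def q_def)
    moreover have "g p \<noteq> g q"
      using g_eq[of p q] pq pq' by blast
    then have "card {g p, g q} = 2"
      by simp
    ultimately have "{g p, g q} = nbrs A (g i)"
      using card_subset_eq[of "nbrs A (g i)" "{g p, g q}"] reg[OF gA[OF ij(1)]] fin
      by (auto simp: nbrs_def)
    then have "g j \<in> {g p, g q}"
      using ij gA by (auto simp: nbrs_def)
    then show ?thesis
      using g_eq[of j p] g_eq[of j q] pq pq' ij by (auto simp: q_def)
  qed
  moreover have "adj (g i) (g j)" if "i < 7" "j < 7" "j = (i + 1) mod 7 \<or> i = (j + 1) mod 7" for i j
    using that succ[of i] sym[OF succ[of j]] by auto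
  ultimately show thesis
    using that[OF bij] by meson
qed

end

section \<open>From dense and sparse sets of a graph to the girth setting\<close>

lemma sparse_set_1_iff:
  assumes "finite S"
  shows "sparse_set 1 G S \<longleftrightarrow>
    S \<subseteq> pverts G \<and> (\<forall>v\<in>S. \<forall>a\<in>S. \<forall>b\<in>S. (v, a) \<in> parcs G \<longrightarrow> (v, b) \<in> parcs G \<longrightarrow> a = b)"
proof -
  have "out_degree (with_proj G \<restriction> S) v \<le> 1 \<longleftrightarrow>
      (\<forall>a\<in>S. \<forall>b\<in>S. (v, a) \<in> parcs G \<longrightarrow> (v, b) \<in> parcs G \<longrightarrow> a = b)" if "v \<in> S" for v
  proof -
    have "out_arcs (with_proj G \<restriction> S) v = Pair v ` {w \<in> S. (v, w) \<in> parcs G}"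
      using that by (auto simp: out_arcs_def induce_subgraph_def)
    then have "out_degree (with_proj G \<restriction> S) v = card {w \<in> S. (v, w) \<in> parcs G}"
      by (simp add: out_degree_def card_image inj_on_def)
    then show ?thesis
      using card_le_Suc0_iff_eq[of "{w \<in> S. (v, w) \<in> parcs G}"] assms by auto
  qed
  then show ?thesis
    by (auto simp: sparse_set_def)
qed

text \<open>In a 4-cycle only the opposite vertex can be a non-neighbour. Conversely, a vertex
  \<open>v\<close> of a 1-dense 4-set has two neighbours \<open>b\<close>, \<open>c\<close> in it;
  these are not adjacent, so both are adjacent to the fourth vertex \<open>d\<close>, and
  \<open>v b d c\<close> is a 4-cycle.\<close>

lemma dense_4_set_iff_C4:
  assumes "pair_graph G" "triangle_free G"
  shows "(\<exists>S. dense_set 1 G S \<and> card S = 4) \<longleftrightarrow>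
    (\<exists>a b c d. a \<noteq> c \<and> b \<noteq> d \<and>
      (a, b) \<in> parcs G \<and> (b, c) \<in> parcs G \<and> (c, d) \<in> parcs G \<and> (d, a) \<in> parcs G)"
proof
  interpret pair_graph G by fact
  have no_loop: "u \<noteq> v" if "(u, v) \<in> parcs G" for u v
    using pair_no_loops[OF that] by simp
  assume "\<exists>a b c d. a \<noteq> c \<and> b \<noteq> d \<and>
      (a, b) \<in> parcs G \<and> (b, c) \<in> parcs G \<and> (c, d) \<in> parcs G \<and> (d, a) \<in> parcs G"
  then obtain a b c d where C4: "a \<noteq> c" "b \<noteq> d"
      "(a, b) \<in> parcs G" "(b, c) \<in> parcs G" "(c, d) \<in> parcs G" "(d, a) \<in> parcs G"
    by blast
  note rev = C4(3-6)[THEN arcs_symmetric]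
  have card: "card X \<le> 1" if "X \<subseteq> {x}" for X and x :: 'a
    using card_mono[OF _ that] by simp
  let ?S = "{a, b, c, d}"
  have "card {u \<in> ?S. u \<noteq> a \<and> (a, u) \<notin> parcs G} \<le> 1"
    by (rule card[of _ c]) (use C4 rev in auto)
  moreover have "card {u \<in> ?S. u \<noteq> b \<and> (b, u) \<notin> parcs G} \<le> 1"
    by (rule card[of _ d]) (use C4 rev in auto)
  moreover have "card {u \<in> ?S. u \<noteq> c \<and> (c, u) \<notin> parcs G} \<le> 1"
    by (rule card[of _ a]) (use C4 rev in auto)
  moreover have "card {u \<in> ?S. u \<noteq> d \<and> (d, u) \<notin> parcs G} \<le> 1"
    by (rule card[of _ b]) (use C4 rev in auto)
  moreover have "?S \<subseteq> pverts G"
    using C4 wellformed' by blast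
  ultimately have "dense_set 1 G ?S"
    unfolding dense_set_def by blast
  moreover have "card ?S = 4"
    using C4(1,2) C4(3-6)[THEN no_loop] by auto
  ultimately show "\<exists>S. dense_set 1 G S \<and> card S = 4"
    by blast
next
  interpret pair_graph G by fact
  assume "\<exists>S. dense_set 1 G S \<and> card S = 4"
  then obtain S where S: "card S = 4"
      "\<And>v. v \<in> S \<Longrightarrow> card {u \<in> S. u \<noteq> v \<and> (v, u) \<notin> parcs G} \<le> 1"
    by (auto simp: dense_set_def)
  have fin: "finite S"
    using S(1) by (simp add: card_ge_0_finite)
  \<comment> \<open>With at most one non-neighbour in \<open>S\<close>, a vertex is adjacent to one
    of any two others.\<close>
  have adj: "(v, u) \<in> parcs G \<or> (v, w) \<in> parcs G"
    if "v \<in> S" "u \<in> S" "w \<in> S" "u \<noteq> v" "w \<noteq> v" "u \<noteq> w" for u v w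
    using S(2)[OF that(1)] card_le_Suc0_iff_eq[of "{u \<in> S. u \<noteq> v \<and> (v, u) \<notin> parcs G}"] fin that
    by auto
  obtain v x y z where S_eq: "S = {v, x, y, z}" and dist: "distinct [v, x, y, z]"
    using S(1) by (auto simp: card_Suc_eq numeral_eq_Suc)
  have no_tri: "\<not> ((a, b) \<in> parcs G \<and> (b, c) \<in> parcs G \<and> (c, a) \<in> parcs G)" for a b c
    using assms(2) unfolding triangle_free_def by blast
  obtain b c d where bcd: "{b, c, d} = {x, y, z}" "distinct [v, b, c, d]"
      "(v, b) \<in> parcs G" "(v, c) \<in> parcs G"
  proof -
    have "(v, x) \<in> parcs G \<or> (v, y) \<in> parcs G" "(v, x) \<in> parcs G \<or> (v, z) \<in> parcs G"
         "(v, y) \<in> parcs G \<or> (v, z) \<in> parcs G"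
      using adj[of v] dist S_eq by auto
    then consider "(v, x) \<in> parcs G" "(v, y) \<in> parcs G" | "(v, x) \<in> parcs G" "(v, z) \<in> parcs G"
      | "(v, y) \<in> parcs G" "(v, z) \<in> parcs G"
      by blast
    then show thesis
      using that[of x y z] that[of x z y] that[of y z x] dist by cases auto
  qed
  have "(b, c) \<notin> parcs G" "(c, b) \<notin> parcs G"
    using no_tri[of v b c] no_tri[of v c b] bcd arcs_symmetric by blast+
  moreover have "v \<in> S" "b \<in> S" "c \<in> S" "d \<in> S"
    using bcd(1) S_eq by blast+
  ultimately have "(b, d) \<in> parcs G" "(c, d) \<in> parcs G"
    using adj[of b c d] adj[of c b d] bcd(2) by auto
  moreover from this have "(d, c) \<in> parcs G" "(c, v) \<in> parcs G"
    using arcs_symmetric bcd(4) by blast+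
  moreover have "v \<noteq> d" "b \<noteq> c"
    using bcd(2) by auto
  ultimately show "\<exists>a b c d. a \<noteq> c \<and> b \<noteq> d \<and>
      (a, b) \<in> parcs G \<and> (b, c) \<in> parcs G \<and> (c, d) \<in> parcs G \<and> (d, a) \<in> parcs G"
    using bcd(3) by blast
qed

lemma girth_ge_5_if_no_dense_or_sparse:
  assumes "pair_graph G" "triangle_free G" "\<not> has_dense_or_sparse 1 4 5 G"
  shows "girth_ge_5 (\<lambda>u v. (u, v) \<in> parcs G)"
    "\<not> girth_ge_5.has_sparse (\<lambda>u v. (u, v) \<in> parcs G) (pverts G) 5"
proof -
  interpret pair_graph G by fact
  have no_C4: "\<not> (\<exists>a b c d. a \<noteq> c \<and> b \<noteq> d \<and>
      (a, b) \<in> parcs G \<and> (b, c) \<in> parcs G \<and> (c, d) \<in> parcs G \<and> (d, a) \<in> parcs G)"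
    using dense_4_set_iff_C4[OF assms(1,2)] assms(3) unfolding has_dense_or_sparse_def by blast
  show "girth_ge_5 (\<lambda>u v. (u, v) \<in> parcs G)"
  proof
    show "(u, u) \<notin> parcs G" for u
      using pair_no_loops by fastforce
    show "(c, a) \<notin> parcs G" if "(a, b) \<in> parcs G" "(b, c) \<in> parcs G" for a b c
      using assms(2) that unfolding triangle_free_def by blast
  qed (use arcs_symmetric no_C4 in blast)+
  then interpret girth_ge_5 "\<lambda>u v. (u, v) \<in> parcs G" .
  show "\<not> has_sparse (pverts G) 5"
  proof
    assume "has_sparse (pverts G) 5"
    then obtain S where S: "S \<subseteq> pverts G" "card S = 5" "sparse1 S"
      unfolding has_sparse_def by blast
    then have "sparse_set 1 G S"
      by (subst sparse_set_1_iff) (auto simp: card_ge_0_finite sparse1_def)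
    then show False
      using S(2) assms(3) unfolding has_dense_or_sparse_def by blast
  qed
qed

lemma has_dense_or_sparse_8:
  assumes "pair_graph G" "triangle_free G" "card (pverts G) = 8"
  shows "has_dense_or_sparse 1 4 5 G"
  using girth_ge_5_if_no_dense_or_sparse[OF assms(1,2)] girth_ge_5.has_sparse_8_5 assms(3) by blast

section \<open>Isomorphisms from vertex bijections, and the cycle on 7 vertices with its induced
  subgraphs\<close>

text \<open>Arcs are pairs of vertices, so \<open>map_prod f f\<close> is the induced action on
  arcs; well-formedness makes it injective on the arcs and onto those of \<open>H\<close>.\<close>

lemma graph_isoI:
  assumes wf: "pair_wf_digraph G" "pair_wf_digraph H"
    and f: "bij_betw f (pverts G) (pverts H)"
    and adj: "\<And>u v. u \<in> pverts G \<Longrightarrow> v \<in> pverts G \<Longrightarrow> (f u, f v) \<in> parcs H \<longleftrightarrow> (u, v) \<in> parcs G"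
  shows "graph_iso G H"
proof -
  interpret G: pair_wf_digraph G by fact
  interpret H: pair_wf_digraph H by fact
  define h where "h = \<lparr>iso_verts = f, iso_arcs = map_prod f f, iso_head = snd, iso_tail = fst\<rparr>"
  have inj: "inj_on f (pverts G)" and surj: "f ` pverts G = pverts H"
    using f by (auto simp: bij_betw_def)
  have "inj_on (map_prod f f) (parcs G)"
    by (rule inj_on_subset[OF map_prod_inj_on[OF inj inj]]) (auto dest: G.wellformed')
  then have "pre_digraph.digraph_isomorphism (with_proj G) h"
    using inj G.wf_digraph_axioms by (auto simp: pre_digraph.digraph_isomorphism_def h_def)
  moreover have "map_prod f f ` parcs G = parcs H"
  proof
    show "map_prod f f ` parcs G \<subseteq> parcs H"
      using adj by (auto dest: G.wellformed')
    show "parcs H \<subseteq> map_prod f f ` parcs G"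
    proof
      fix e assume e: "e \<in> parcs H"
      then have "fst e \<in> f ` pverts G" "snd e \<in> f ` pverts G"
        using H.arc_fst_in_verts H.arc_snd_in_verts surj by blast+
      then obtain u v where uv: "u \<in> pverts G" "v \<in> pverts G" "e = (f u, f v)"
        by (metis imageE prod.collapse)
      then show "e \<in> map_prod f f ` parcs G"
        using adj e by force
    qed
  qed
  then have "with_proj H = app_iso h (with_proj G)"
    using surj by (simp add: app_iso_def h_def with_proj_def)
  ultimately show ?thesis
    unfolding graph_iso_def digraph_iso_def by blast
qed

text \<open>
  The least-number operator in \<open>R_triangle\<close> needs a counterexample at every order below 8, not only
  at 7; induced subgraphs of \<open>C\<^sub>7\<close> serve.
\<close>

definition cycle7_part :: "nat \<Rightarrow> nat pair_pre_digraph" where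
  "cycle7_part n =
     \<lparr> pverts = {..<n},
       parcs = {(u, v). u < n \<and> v < n \<and> (v = (u + 1) mod 7 \<or> u = (v + 1) mod 7)} \<rparr>"

lemma card_cycle_graph: "card (pverts (cycle_graph n)) = n"
  by (simp add: cycle_graph_def)

lemma cycle7_part_7: "cycle7_part 7 = cycle_graph 7"
  by (simp add: cycle7_part_def cycle_graph_def)

lemma Suc_mod_7: "u < 7 \<Longrightarrow> Suc u mod 7 = (if u = 6 then 0 else Suc u)"
  by auto

text \<open>Removing the modulus makes the case checks linear. The wrap-around edge between 6 and 0
  is present only for \<open>n = 7\<close>.\<close>

lemma cycle7_part_arc_iff:
  "n \<le> 7 \<Longrightarrow> (u, v) \<in> parcs (cycle7_part n) \<longleftrightarrow>
    u < n \<and> v < n \<and> (v = u + 1 \<or> u = v + 1 \<or> u = 6 \<and> v = 0 \<or> u = 0 \<and> v = 6)"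
  by (auto simp: cycle7_part_def Suc_mod_7 split: if_splits)

lemma pair_graph_cycle7_part:
  assumes "n \<le> 7"
  shows "pair_graph (cycle7_part n)"
proof
  show "finite (pverts (cycle7_part n))"
    by (simp add: cycle7_part_def)
  show "finite (parcs (cycle7_part n))"
    by (rule finite_subset[of _ "{..<n} \<times> {..<n}"]) (auto simp: cycle7_part_def)
  show "symmetric (with_proj (cycle7_part n))"
    using assms by (auto simp: symmetric_def sym_def cycle7_part_arc_iff)
next
  fix e assume "e \<in> parcs (cycle7_part n)"
  then show "fst e \<in> pverts (cycle7_part n)" "snd e \<in> pverts (cycle7_part n)" "fst e \<noteq> snd e"
    using assms cycle7_part_arc_iff[OF assms, of "fst e" "snd e"]
    by (auto simp: cycle7_part_def)
qed

lemma triangle_free_cycle7_part: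
  assumes "n \<le> 7"
  shows "triangle_free (cycle7_part n)"
  unfolding triangle_free_def
proof
  assume "\<exists>u v w. (u, v) \<in> parcs (cycle7_part n) \<and> (v, w) \<in> parcs (cycle7_part n) \<and>
    (w, u) \<in> parcs (cycle7_part n)"
  then obtain u v w where C3: "(u, v) \<in> parcs (cycle7_part n)" "(v, w) \<in> parcs (cycle7_part n)"
      "(w, u) \<in> parcs (cycle7_part n)"
    by blast
  then have "u < 7"
    using assms by (simp add: cycle7_part_def)
  then have "u \<in> {0, 1, 2, 3, 4, 5, 6}"
    by auto
  then show False
    using C3 unfolding cycle7_part_arc_iff[OF assms] by (elim insertE emptyE; force)
qed

lemma common_nbr_unique_cycle7_part:
  assumes n: "n \<le> 7" and "b \<noteq> d"
    and a: "(a, b) \<in> parcs (cycle7_part n)" "(a, d) \<in> parcs (cycle7_part n)"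
    and c: "(c, b) \<in> parcs (cycle7_part n)" "(c, d) \<in> parcs (cycle7_part n)"
  shows "a = c"
proof -
  have "b < 7" "d < 7"
    using n a by (simp_all add: cycle7_part_def)
  then have "b \<in> {0, 1, 2, 3, 4, 5, 6}" "d \<in> {0, 1, 2, 3, 4, 5, 6}"
    by auto
  then show ?thesis
    using \<open>b \<noteq> d\<close> a c unfolding cycle7_part_arc_iff[OF n] by (elim insertE emptyE; force)
qed

text \<open>The six vertices other than \<open>x\<close> split into two arcs of three, centred at
  \<open>x + 2\<close> and \<open>x + 5\<close> modulo 7; \<open>y\<close> lies in at most one of
  them.\<close>

lemma two_points_miss_arc_of_C7:
  fixes x y :: nat
  assumes "x < 7" "y < 7"
  shows "\<exists>v<7. {v, (v + 1) mod 7, (v + 6) mod 7} \<inter> {x, y} = {}"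
proof -
  let ?misses = "\<lambda>v. {v, (v + 1) mod 7, (v + 6) mod 7} \<inter> {x, y} = {}"
  have "x \<in> {0, 1, 2, 3, 4, 5, 6}" "y \<in> {0, 1, 2, 3, 4, 5, 6}"
    using assms by auto
  then have "?misses ((x + 2) mod 7) \<or> ?misses ((x + 5) mod 7)"
    by (elim insertE emptyE; simp)
  then show ?thesis
    by (meson mod_less_divisor zero_less_numeral)
qed

lemma no_dense_or_sparse_cycle7_part:
  assumes n: "n \<le> 7"
  shows "\<not> has_dense_or_sparse 1 4 5 (cycle7_part n)"
proof -
  interpret pair_graph "cycle7_part n"
    using n by (rule pair_graph_cycle7_part)
  have "\<not> (\<exists>S. dense_set 1 (cycle7_part n) S \<and> card S = 4)"
    unfolding dense_4_set_iff_C4[OF pair_graph_cycle7_part[OF n] triangle_free_cycle7_part[OF n]]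
    using common_nbr_unique_cycle7_part[OF n] arcs_symmetric by meson
  moreover have False if S: "sparse_set 1 (cycle7_part n) S" "card S = 5" for S
  proof -
    have S_sub: "S \<subseteq> {..<n}"
      using S(1) by (simp add: sparse_set_def cycle7_part_def)
    have fin: "finite S"
      using S(2) by (simp add: card_ge_0_finite)
    \<comment> \<open>The complement is taken in the whole cycle even if \<open>n < 7\<close>, so
      that exactly two vertices are missing; the arc avoiding them lies in \<open>S\<close> and
      therefore below \<open>n\<close>.\<close>
    have "card ({..<7} - S) = 2"
      using S_sub S(2) n fin by (subst card_Diff_subset) auto
    then obtain x y where xy: "{..<7} - S = {x, y}"
      by (auto simp: card_2_iff)
    then have "x < 7" "y < 7"
      by blast+
    then obtain v where v: "v < 7" "{v, (v + 1) mod 7, (v + 6) mod 7} \<inter> {x, y} = {}"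
      using two_points_miss_arc_of_C7[of x y] by blast
    have "w \<in> S" if "w < 7" "w \<notin> {x, y}" for w
      using that xy by blast
    then have vS: "v \<in> S" "(v + 1) mod 7 \<in> S" "(v + 6) mod 7 \<in> S"
      using v by simp_all
    have "v \<in> {0, 1, 2, 3, 4, 5, 6}"
      using v(1) by auto
    then have mod: "v = ((v + 6) mod 7 + 1) mod 7" "(v + 1) mod 7 \<noteq> (v + 6) mod 7"
      by auto
    from mod(1) have "(v, (v + 1) mod 7) \<in> parcs (cycle7_part n)"
      "(v, (v + 6) mod 7) \<in> parcs (cycle7_part n)"
      using subsetD[OF S_sub vS(1)] subsetD[OF S_sub vS(2)] subsetD[OF S_sub vS(3)]
      unfolding cycle7_part_def by simp_all
    with vS mod(2) S(1) show False
      unfolding sparse_set_1_iff[OF fin] by blast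
  qed
  ultimately show ?thesis
    unfolding has_dense_or_sparse_def by blast
qed

section \<open>Uniqueness of the extremal graph and the value of the Ramsey number\<close>

lemma graph_iso_cycle_graph_7:
  assumes "pair_graph G" "triangle_free G" "card (pverts G) = 7" "\<not> has_dense_or_sparse 1 4 5 G"
  shows "graph_iso G (cycle_graph 7)"
proof -
  interpret pair_graph G by fact
  interpret girth_ge_5 "\<lambda>u v. (u, v) \<in> parcs G"
    using girth_ge_5_if_no_dense_or_sparse assms by blast
  have "card (nbrs (pverts G) v) = 2" if "v \<in> pverts G" for v
    using degree_eq_2 girth_ge_5_if_no_dense_or_sparse assms that by blast
  then obtain g where g: "bij_betw g {..<7::nat} (pverts G)"
    and adj: "\<And>i j. i < 7 \<Longrightarrow> j < 7 \<Longrightarrow>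
      (g i, g j) \<in> parcs G \<longleftrightarrow> j = (i + 1) mod 7 \<or> i = (j + 1) mod 7"
    using two_regular_7[OF assms(3)] by metis
  interpret C: pair_graph "cycle_graph 7"
    using pair_graph_cycle7_part[of 7] by (simp add: cycle7_part_7)
  \<comment> \<open>\<open>g\<close> numbers the vertices of \<open>G\<close> along the cycle; the
    isomorphism sends each vertex to its number.\<close>
  let ?f = "the_inv_into {..<7} g"
  have f: "bij_betw ?f (pverts G) (pverts (cycle_graph 7))"
    using bij_betw_the_inv_into[OF g] by (simp add: cycle_graph_def)
  show ?thesis
  proof (rule graph_isoI[OF _ _ f])
    fix u v assume "u \<in> pverts G" "v \<in> pverts G"
    then have "?f u < 7" "?f v < 7" "g (?f u) = u" "g (?f v) = v"
      using f g f_the_inv_into_f_bij_betw[OF g] by (auto simp: bij_betw_def cycle_graph_def)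
    then show "(?f u, ?f v) \<in> parcs (cycle_graph 7) \<longleftrightarrow> (u, v) \<in> parcs G"
      using adj[of "?f u" "?f v"] by (simp add: cycle_graph_def)
  qed unfold_locales
qed

lemma R_triangle_1_4_5: "R_triangle 1 4 5 = 8"
  unfolding R_triangle_def
proof (rule Least_equality)
  show "\<forall>G :: nat pair_pre_digraph.
      pair_graph G \<and> triangle_free G \<and> card (pverts G) = 8 \<longrightarrow> has_dense_or_sparse 1 4 5 G"
    using has_dense_or_sparse_8 by blast
next
  fix n assume n: "\<forall>G :: nat pair_pre_digraph.
      pair_graph G \<and> triangle_free G \<and> card (pverts G) = n \<longrightarrow> has_dense_or_sparse 1 4 5 G"
  show "8 \<le> n"
  proof (rule ccontr)
    assume "\<not> 8 \<le> n"
    then have "n \<le> 7"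
      by simp
    moreover have "card (pverts (cycle7_part n)) = n"
      by (simp add: cycle7_part_def)
    ultimately show False
      using n pair_graph_cycle7_part triangle_free_cycle7_part no_dense_or_sparse_cycle7_part
      by blast
  qed
qed

text \<open>\<open>R_triangle\<close> quantifies over graphs on \<open>nat\<close>; the last two
  conjuncts give the claims for 8 and 7 vertices explicitly over an arbitrary vertex type.\<close>

theorem theorem4p2:
  shows "R_triangle 1 4 5 = 8 \<and>
    extremal 1 4 5 (cycle_graph 7) \<and>
    (\<forall>G :: 'a pair_pre_digraph. extremal 1 4 5 G \<longrightarrow> graph_iso G (cycle_graph 7)) \<and>
    (\<forall>G :: 'a pair_pre_digraph.
       pair_graph G \<and> triangle_free G \<and> card (pverts G) = 8 \<longrightarrow>
       (\<exists>S. dense_set 1 G S \<and> card S = 4) \<or> (\<exists>S. sparse_set 1 G S \<and> card S = 5)) \<and>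
    (\<forall>G :: 'a pair_pre_digraph.
       pair_graph G \<and> triangle_free G \<and> card (pverts G) = 7 \<and>
       \<not> (\<exists>S. dense_set 1 G S \<and> card S = 4) \<and> \<not> (\<exists>S. sparse_set 1 G S \<and> card S = 5) \<longrightarrow>
       graph_iso G (cycle_graph 7))"
proof (intro conjI allI impI)
  show "R_triangle 1 4 5 = 8"
    by (rule R_triangle_1_4_5)
  have "pair_graph (cycle_graph 7)" "triangle_free (cycle_graph 7)"
    "\<not> has_dense_or_sparse 1 4 5 (cycle_graph 7)"
    using pair_graph_cycle7_part[of 7] triangle_free_cycle7_part[of 7]
      no_dense_or_sparse_cycle7_part[of 7] by (simp_all add: cycle7_part_7)
  then show "extremal 1 4 5 (cycle_graph 7)"
    unfolding extremal_def R_triangle_1_4_5 by (simp add: card_cycle_graph)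
  show "graph_iso G (cycle_graph 7)" if "extremal 1 4 5 G" for G :: "'a pair_pre_digraph"
    using that graph_iso_cycle_graph_7[of G] unfolding extremal_def R_triangle_1_4_5 by simp
next
  fix G :: "'a pair_pre_digraph"
  assume G: "pair_graph G \<and> triangle_free G \<and> card (pverts G) = 8"
  then show "(\<exists>S. dense_set 1 G S \<and> card S = 4) \<or> (\<exists>S. sparse_set 1 G S \<and> card S = 5)"
    using has_dense_or_sparse_8[of G] unfolding has_dense_or_sparse_def by blast
next
  fix G :: "'a pair_pre_digraph"
  assume "pair_graph G \<and> triangle_free G \<and> card (pverts G) = 7 \<and>
    \<not> (\<exists>S. dense_set 1 G S \<and> card S = 4) \<and> \<not> (\<exists>S. sparse_set 1 G S \<and> card S = 5)"
  then show "graph_iso G (cycle_graph 7)"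
    using graph_iso_cycle_graph_7[of G] unfolding has_dense_or_sparse_def by blast
qed

end
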